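(* Let $A$ be a ring (not necessarily commutative) such that $\mathrm{Spec}(A)$ satisfies (K2), meaning: for all $P<Q$ in $\mathrm{Spec}(A)$ there exist $P\le P'<Q'\le Q$ in $\mathrm{Spec}(A)$ such that $P'$ and $Q'$ are immediate neighbors in $\mathrm{Spec}(A)$. If $\mathrm{Spec}(A)$ is totally ordered, then $\mathrm{Spec}(A)$ is order isomorphic to $D(\mathrm{IS}(\mathrm{Spec}(A)))$ and to $D(\mathrm{IP}(\mathrm{Spec}(A)))$. In particular, there exists a Dedekind totally ordered set which is order isomorphic to $\mathrm{Spec}(A)$.
   Context: Rings are associative, nonzero, with identity. $\mathrm{Spec}(A)$ is the set of all prime (two-sided) ideals of $A$, ordered by inclusion. For a poset $S$, $a,b\in S$ are immediate neighbors in $S$ if $a<b$ and there is no $c\in S$ with $a<c<b$; then $a$ is an immediate predecessor of $b$ and $b$ an immediate successor of $a$. $\mathrm{IS}(S)$ is the set of elements of $S$ having an immediate predecessor in $S$, and $\mathrm{IP}(S)$ is the set of elements of $S$ having an immediate successor in $S$; both carry the induced order. A cut of a totally ordered set $T$ is a pair $\mathcal A=(\mathcal A^L,\mathcal A^R)$ of disjoint (possibly empty) subsets with $\mathcal A^L\cup\mathcal A^R=T$ such that $\alpha<\beta$ for all $\alpha\in\mathcal A^L$, $\beta\in\mathcal A^R$. $D(T)$ is the set of all cuts of $T$ (including $(\emptyset,T)$ and $(T,\emptyset)$; $D(\emptyset)$ has exactly one element), totally ordered by $\mathcal A\le\mathcal B$ iff $\mathcal A^L\subseteq\mathcal B^L$.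 A totally ordered set $T'$ is a Dedekind totally ordered set if there is a totally ordered set $T$ such that $T'$ is order isomorphic to $D(T)$. *)

theory Defs
  imports "HOL-Algebra.Ideal_Product"
begin

text \<open>
  A poset is a relation \<open>r\<close> with \<^term>\<open>Partial_order r\<close>. Such a relation is reflexive on its
  field, so the underlying set is \<^term>\<open>Field r\<close>, the strict order is \<^term>\<open>r - Id\<close>, and the
  order induced on a subset \<open>A\<close> is \<^term>\<open>Restr r A\<close>.
\<close>

definition order_isomorphic :: "'a rel \<Rightarrow> 'b rel \<Rightarrow> bool" where
  "order_isomorphic r s \<longleftrightarrow>
    (\<exists>f. bij_betw f (Field r) (Field s) \<and>
         (\<forall>a\<in>Field r. \<forall>b\<in>Field r. (a, b) \<in> r \<longleftrightarrow> (f a, f b) \<in> s))"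

definition immediate_neighbors :: "'a rel \<Rightarrow> 'a \<Rightarrow> 'a \<Rightarrow> bool" where
  "immediate_neighbors r a b \<longleftrightarrow>
    (a, b) \<in> r - Id \<and> \<not> (\<exists>c. (a, c) \<in> r - Id \<and> (c, b) \<in> r - Id)"

definition IS :: "'a rel \<Rightarrow> 'a rel" where
  "IS r = Restr r {b \<in> Field r. \<exists>a. immediate_neighbors r a b}"

definition IP :: "'a rel \<Rightarrow> 'a rel" where
  "IP r = Restr r {a \<in> Field r. \<exists>b. immediate_neighbors r a b}"

definition K2 :: "'a rel \<Rightarrow> bool" where
  "K2 r \<longleftrightarrow>
    (\<forall>P Q. (P, Q) \<in> r - Id \<longrightarrow>
      (\<exists>P' Q'. (P, P') \<in> r \<and> immediate_neighbors r P' Q' \<and> (Q', Q) \<in> r))"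

definition is_cut :: "'a rel \<Rightarrow> 'a set \<times> 'a set \<Rightarrow> bool" where
  "is_cut r = (\<lambda>(L, U). L \<inter> U = {} \<and> L \<union> U = Field r \<and>
    (\<forall>\<alpha>\<in>L. \<forall>\<beta>\<in>U. (\<alpha>, \<beta>) \<in> r - Id))"

definition cut_order :: "'a rel \<Rightarrow> ('a set \<times> 'a set) rel" where
  "cut_order r = {(A, B). is_cut r A \<and> is_cut r B \<and> fst A \<subseteq> fst B}"

text \<open>
  A quantifier cannot range over types, so the totally ordered set \<open>t\<close> below is taken from the
  element type of \<open>r\<close>. No generality is lost: \<open>dedekind_orderI\<close> shows that \<open>t\<close> may
  live in any type.
\<close>

definition dedekind_order :: "'a rel \<Rightarrow> bool" where
  "dedekind_order r \<longleftrightarrow> Linear_order r \<and>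
    (\<exists>t :: 'a rel. Linear_order t \<and> order_isomorphic r (cut_order t))"

text \<open>
  The library's \<^const>\<open>primeideal\<close> requires a commutative ring, hence the definition by
  products of two-sided ideals.
\<close>

definition prime_ideal :: "('a, 'b) ring_scheme \<Rightarrow> 'a set \<Rightarrow> bool" where
  "prime_ideal R P \<longleftrightarrow> ideal P R \<and> P \<noteq> carrier R \<and>
    (\<forall>I J. ideal I R \<longrightarrow> ideal J R \<longrightarrow> I \<cdot>\<^bsub>R\<^esub> J \<subseteq> P \<longrightarrow> I \<subseteq> P \<or> J \<subseteq> P)"

definition Spec :: "('a, 'b) ring_scheme \<Rightarrow> 'a set rel" where
  "Spec R = {(P, Q). prime_ideal R P \<and> prime_ideal R Q \<and> P \<subseteq> Q}"

lemma Field_Spec: "Field (Spec R) = {P. prime_ideal R P}"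
  by (auto simp: Field_def Spec_def)

lemma Partial_order_Spec: "Partial_order (Spec R)"
  unfolding order_on_defs Field_Spec
  by (auto simp: Spec_def refl_on_def trans_def antisym_def)

lemma Field_cut_order: "Field (cut_order r) = {A. is_cut r A}"
  by (auto simp: Field_def cut_order_def)

lemma Linear_order_cut_order:
  assumes "Linear_order r"
  shows "Linear_order (cut_order r)"
proof -
  have eq: "A = B" if "is_cut r A" "is_cut r B" "fst A = fst B" for A B
  proof (rule prod_eqI)
    have "snd A = Field r - fst A" "snd B = Field r - fst B"
      using that(1,2) by (auto simp: is_cut_def split_beta)
    with that(3) show "snd A = snd B" by simp
  qed (fact that(3))
  have anti: "antisym (cut_order r)"
  proof (rule antisymI)
    fix A B assume "(A, B) \<in> cut_order r" "(B, A) \<in> cut_order r"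
    then show "A = B"
      unfolding cut_order_def by (intro eq) blast+
  qed
  have tot: "fst A \<subseteq> fst B \<or> fst B \<subseteq> fst A" if A: "is_cut r A" and B: "is_cut r B" for A B
  proof (rule ccontr)
    assume "\<not> ?thesis"
    then obtain x y where "x \<in> fst A" "x \<notin> fst B" "y \<in> fst B" "y \<notin> fst A" by blast
    moreover from this A B have "x \<in> snd B" "y \<in> snd A"
      unfolding is_cut_def split_beta by blast+
    ultimately have "(x, y) \<in> r - Id" "(y, x) \<in> r - Id"
      using A B unfolding is_cut_def split_beta by blast+
    with assms show False
      by (auto simp: order_on_defs antisym_def)
  qed
  show ?thesis
    using anti tot unfolding order_on_defs Field_cut_order
    by (auto simp: cut_order_def refl_on_def trans_def total_on_def)
qed

lemma is_cut_below:
  assumes t: "Linear_order t" and x: "x \<in> Field t"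
  shows "is_cut t ({y. (y, x) \<in> t}, {y. (x, y) \<in> t - Id})"
proof -
  have tr: "trans t" and anti: "antisym t" and "total_on (Field t) t" "refl_on (Field t) t"
    using t by (auto simp: order_on_defs)
  then have refl: "(x, x) \<in> t" and tot: "\<forall>y\<in>Field t. (y, x) \<in> t \<or> (x, y) \<in> t"
    using x unfolding total_on_def refl_on_def by metis+
  have "{y. (y, x) \<in> t} \<inter> {y. (x, y) \<in> t - Id} = {}"
    using anti unfolding antisym_def by blast
  moreover have "{y. (y, x) \<in> t} \<union> {y. (x, y) \<in> t - Id} = Field t"
  proof (intro equalityI subsetI)
    fix y assume "y \<in> {y. (y, x) \<in> t} \<union> {y. (x, y) \<in> t - Id}"
    then show "y \<in> Field t" by (auto intro: FieldI1 FieldI2)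
  next
    fix y assume "y \<in> Field t"
    then show "y \<in> {y. (y, x) \<in> t} \<union> {y. (x, y) \<in> t - Id}"
      using tot refl by auto
  qed
  moreover have "(y, z) \<in> t - Id" if "(y, x) \<in> t" "(x, z) \<in> t - Id" for y z
    using tr anti that unfolding trans_def antisym_def by blast
  ultimately show ?thesis
    by (simp add: is_cut_def)
qed

lemma Linear_order_transfer:
  assumes t: "Linear_order t" and inj: "inj_on f (Field t)"
  shows "Field (map_prod f f ` t) = f ` Field t" "Linear_order (map_prod f f ` t)"
    "\<And>a b. a \<in> Field t \<Longrightarrow> b \<in> Field t \<Longrightarrow>
      (f a, f b) \<in> map_prod f f ` t \<longleftrightarrow> (a, b) \<in> t"
proof -
  show F: "Field (map_prod f f ` t) = f ` Field t"
    by (force simp: Field_def)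
  show iff: "(f a, f b) \<in> map_prod f f ` t \<longleftrightarrow> (a, b) \<in> t"
    if "a \<in> Field t" "b \<in> Field t" for a b
  proof
    assume "(f a, f b) \<in> map_prod f f ` t"
    then obtain a' b' where ab: "(a', b') \<in> t" "f a = f a'" "f b = f b'" by auto
    then have "a' \<in> Field t" "b' \<in> Field t" by (meson FieldI1 FieldI2)+
    then have "a' = a" "b' = b" using ab(2,3) that by (auto dest: inj_onD[OF inj])
    with ab(1) show "(a, b) \<in> t" by simp
  next
    assume "(a, b) \<in> t"
    then show "(f a, f b) \<in> map_prod f f ` t" by (metis image_eqI map_prod_simp)
  qed
  define s where "s = map_prod f f ` t"
  note F = F[folded s_def] and iff = iff[folded s_def]
  have sub: "s \<subseteq> f ` Field t \<times> f ` Field t"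
    unfolding s_def by (auto intro: FieldI1 FieldI2)
  have "trans t" "antisym t" "total_on (Field t) t" "refl_on (Field t) t"
    using t by (auto simp: order_on_defs)
  note t' = this
  have "refl_on (f ` Field t) s"
    using t'(4) iff unfolding refl_on_def by blast
  moreover have "trans s"
  proof (rule transI)
    fix a b c assume ab: "(a, b) \<in> s" "(b, c) \<in> s"
    then obtain a' b' c' where eq: "a = f a'" "b = f b'" "c = f c'"
      and C: "a' \<in> Field t" "b' \<in> Field t" "c' \<in> Field t" using sub by blast
    from ab have "(a', b') \<in> t" "(b', c') \<in> t"
      unfolding eq using iff[OF C(1,2)] iff[OF C(2,3)] by blast+
    then have "(a', c') \<in> t" by (rule transD[OF t'(1)])
    then show "(a, c) \<in> s" unfolding eq using iff[OF C(1,3)] by blast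
  qed
  moreover have "antisym s"
  proof (rule antisymI)
    fix a b assume ab: "(a, b) \<in> s" "(b, a) \<in> s"
    then obtain a' b' where eq: "a = f a'" "b = f b'" and C: "a' \<in> Field t" "b' \<in> Field t"
      using sub by blast
    from ab have "(a', b') \<in> t" "(b', a') \<in> t"
      unfolding eq using iff[OF C] iff[OF C(2,1)] by blast+
    then have "a' = b'" by (rule antisymD[OF t'(2)])
    then show "a = b" by (simp add: eq)
  qed
  moreover have "total_on (f ` Field t) s"
  proof (rule total_onI)
    fix a b assume "a \<in> f ` Field t" "b \<in> f ` Field t" and ne: "a \<noteq> b"
    then obtain a' b' where eq: "a = f a'" "b = f b'" and C: "a' \<in> Field t" "b' \<in> Field t"
      by blast
    with ne have "a' \<noteq> b'" by blast
    with C t'(3) have "(a', b') \<in> t \<or> (b', a') \<in> t" unfolding total_on_def by blast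
    then show "(a, b) \<in> s \<or> (b, a) \<in> s"
      unfolding eq using iff[OF C] iff[OF C(2,1)] by blast
  qed
  ultimately show "Linear_order (map_prod f f ` t)"
    unfolding linear_order_on_def partial_order_on_def preorder_on_def s_def[symmetric] F
    using sub by blast
qed

lemma cut_order_transfer:
  assumes t: "Linear_order t" and inj: "inj_on f (Field t)"
  shows "order_isomorphic (cut_order t) (cut_order (map_prod f f ` t))"
proof -
  let ?s = "map_prod f f ` t"
  note tr = Linear_order_transfer[OF t inj]
  define h where "h = (\<lambda>A. (f ` fst A, f ` snd A))"
  have sub: "fst A \<subseteq> Field t" "snd A \<subseteq> Field t" if "is_cut t A" for A
    using that by (cases A; auto simp: is_cut_def)+
  have cutI: "is_cut ?s (f ` L, f ` U) \<longleftrightarrow> is_cut t (L, U)"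
    if LU: "L \<subseteq> Field t" "U \<subseteq> Field t" for L U
  proof -
    have "f ` L \<inter> f ` U = {} \<longleftrightarrow> L \<inter> U = {}"
      using inj LU by (metis image_is_empty inj_on_image_Int)
    moreover have "f ` L \<union> f ` U = Field ?s \<longleftrightarrow> L \<union> U = Field t"
      unfolding tr(1) using inj LU
      by (metis Un_least image_Un inj_on_image_eq_iff order_refl)
    moreover have "(f a, f b) \<in> ?s - Id \<longleftrightarrow> (a, b) \<in> t - Id" if "a \<in> L" "b \<in> U" for a b
      using that LU tr(3)[of a b] inj by (auto simp: inj_on_def subset_eq)
    ultimately show ?thesis by (simp add: is_cut_def)
  qed
  have "inj_on h {A. is_cut t A}"
  proof (rule inj_onI)
    fix A B assume "A \<in> {A. is_cut t A}" "B \<in> {A. is_cut t A}" and h: "h A = h B"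
    then have s: "fst A \<subseteq> Field t" "fst B \<subseteq> Field t" "snd A \<subseteq> Field t" "snd B \<subseteq> Field t"
      using sub by auto
    have "f ` fst A = f ` fst B" "f ` snd A = f ` snd B" using h by (auto simp: h_def)
    then show "A = B"
      using s inj by (metis inj_on_image_eq_iff prod_eqI)
  qed
  moreover have "h ` {A. is_cut t A} = {A. is_cut ?s A}"
  proof (intro equalityI subsetI)
    fix B assume "B \<in> h ` {A. is_cut t A}"
    then obtain A where A: "is_cut t A" "B = h A" by blast
    then show "B \<in> {A. is_cut ?s A}"
      using cutI[OF sub[OF A(1)]] by (simp add: h_def)
  next
    fix B assume B: "B \<in> {A. is_cut ?s A}"
    then have "fst B \<subseteq> f ` Field t" "snd B \<subseteq> f ` Field t"
      unfolding tr(1)[symmetric] by (cases B; auto simp: is_cut_def)+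
    then obtain L U where LU: "L \<subseteq> Field t" "U \<subseteq> Field t" "fst B = f ` L" "snd B = f ` U"
      by (meson subset_imageE)
    then have "B = h (L, U)" by (simp add: h_def prod_eq_iff)
    moreover have "is_cut t (L, U)"
      using B cutI[OF LU(1,2)] LU(3,4) by (metis mem_Collect_eq prod.collapse)
    ultimately show "B \<in> h ` {A. is_cut t A}" by blast
  qed
  ultimately have bij: "bij_betw h (Field (cut_order t)) (Field (cut_order ?s))"
    by (simp add: bij_betw_def Field_cut_order)
  have "(A, B) \<in> cut_order t \<longleftrightarrow> (h A, h B) \<in> cut_order ?s"
    if A: "is_cut t A" and B: "is_cut t B" for A B
  proof -
    have "fst A \<subseteq> fst B \<longleftrightarrow> f ` fst A \<subseteq> f ` fst B"
      using inj_on_image_mem_iff[OF inj _ sub(1)[OF B]] sub(1)[OF A]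
      by (auto simp: image_subset_iff subset_eq)
    then show ?thesis
      using A B cutI[OF sub[OF A]] cutI[OF sub[OF B]] by (simp add: cut_order_def h_def)
  qed
  with bij show ?thesis
    unfolding order_isomorphic_def by (intro exI[of _ h]) (simp add: Field_cut_order)
qed

lemma order_isomorphic_trans:
  assumes "order_isomorphic r s" and "order_isomorphic s t"
  shows "order_isomorphic r t"
proof -
  obtain f where f: "bij_betw f (Field r) (Field s)"
    "\<And>a b. a \<in> Field r \<Longrightarrow> b \<in> Field r \<Longrightarrow> (a, b) \<in> r \<longleftrightarrow> (f a, f b) \<in> s"
    using assms(1) unfolding order_isomorphic_def by blast
  obtain g where g: "bij_betw g (Field s) (Field t)"
    "\<And>a b. a \<in> Field s \<Longrightarrow> b \<in> Field s \<Longrightarrow> (a, b) \<in> s \<longleftrightarrow> (g a, g b) \<in> t"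
    using assms(2) unfolding order_isomorphic_def by blast
  have "\<forall>a\<in>Field r. f a \<in> Field s" using f(1) by (auto simp: bij_betw_def)
  then show ?thesis
    unfolding order_isomorphic_def using bij_betw_trans[OF f(1) g(1)] f(2) g(2)
    by (intro exI[of _ "g \<circ> f"]) simp
qed

lemma dedekind_orderI:
  fixes r :: "'a rel" and t :: "'b rel"
  assumes r: "Linear_order r" and t: "Linear_order t"
    and iso: "order_isomorphic r (cut_order t)"
  shows "dedekind_order r"
proof -
  obtain f where f: "bij_betw f (Field r) (Field (cut_order t))"
    using iso unfolding order_isomorphic_def by blast
  define c where "c x = ({y. (y, x) \<in> t}, {y. (x, y) \<in> t - Id})" for x
  define g where "g = inv_into (Field r) f \<circ> c"
  have c: "c ` Field t \<subseteq> Field (cut_order t)"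
    using is_cut_below[OF t] by (auto simp: c_def Field_cut_order)
  have "inj_on c (Field t)"
  proof (rule inj_onI)
    fix x y assume "x \<in> Field t" "y \<in> Field t" "c x = c y"
    then have "(x, x) \<in> t" "(y, y) \<in> t" "{z. (z, x) \<in> t} = {z. (z, y) \<in> t}"
      using t by (auto simp: c_def order_on_defs refl_on_def)
    then show "x = y" using t unfolding order_on_defs antisym_def by blast
  qed
  moreover have "inj_on (inv_into (Field r) f) (c ` Field t)"
    using bij_betw_inv_into[OF f] c by (meson bij_betw_def inj_on_subset)
  ultimately have g: "inj_on g (Field t)"
    unfolding g_def by (rule comp_inj_on)
  show ?thesis
    unfolding dedekind_order_def
    using r Linear_order_transfer(2)[OF t g]
      order_isomorphic_trans[OF iso cut_order_transfer[OF t g]] by blast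
qed

end

theory Submission
  imports Defs "HOL-Algebra.Ring_Divisibility"
begin

text \<open>
  A totally ordered spectrum is a complete lattice. Infima of nonempty sets are intersections, and
  the infimum of the empty set is a maximal ideal. Suprema must be obtained from infima: over a
  noncommutative ring the union of a chain of prime ideals need not be prime. In a complete total
  order with (K2), every element \<open>x\<close> is determined by the cut that it induces on the elements with
  an immediate predecessor, and a cut \<open>(L, U)\<close> of these is induced by the supremum of \<open>L\<close>: this
  supremum is not in \<open>U\<close>, because otherwise its predecessor would bound \<open>L\<close>. The argument for the
  elements with an immediate successor is dual.
\<close>

section \<open>Complete total orders and immediate neighbors\<close>

text \<open>The equivalence is the universal property of an infimum \<open>m\<close> of
  \<open>S\<close>. Since \<open>S = {}\<close> is allowed, a greatest element is demanded as
  well.\<close>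

definition complete_order :: "'a rel \<Rightarrow> bool" where
  "complete_order r \<longleftrightarrow>
    (\<forall>S\<subseteq>Field r. \<exists>m\<in>Field r. \<forall>x\<in>Field r. (x, m) \<in> r \<longleftrightarrow> (\<forall>s\<in>S. (x, s) \<in> r))"

text \<open>The supremum is the infimum of the set \<open>?U\<close> of upper bounds: each member of
  \<open>S\<close> is below all of \<open>?U\<close>, hence below its infimum.\<close>

lemma complete_order_lub:
  assumes "Partial_order r" and "complete_order r" and S: "S \<subseteq> Field r"
  obtains m where "m \<in> Field r" "\<And>x. x \<in> Field r \<Longrightarrow> (m, x) \<in> r \<longleftrightarrow> (\<forall>s\<in>S. (s, x) \<in> r)"
proof -
  have r: "trans r" "refl_on (Field r) r"
    using assms(1) by (auto simp: order_on_defs)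
  let ?U = "{u \<in> Field r. \<forall>s\<in>S. (s, u) \<in> r}"
  obtain m where m: "m \<in> Field r"
    "\<And>x. x \<in> Field r \<Longrightarrow> (x, m) \<in> r \<longleftrightarrow> (\<forall>u\<in>?U. (x, u) \<in> r)"
    using assms(2)[unfolded complete_order_def, rule_format, of ?U] by auto
  have "(s, m) \<in> r" if "s \<in> S" for s
    using that S m(2) by blast
  moreover have "(m, x) \<in> r" if "x \<in> Field r" "\<forall>s\<in>S. (s, x) \<in> r" for x
    using that m r(2) unfolding refl_on_def by blast
  ultimately show thesis
    using that[OF m(1)] r(1) unfolding trans_def by blast
qed

lemma Linear_order_less_iff:
  assumes "Linear_order r" and "x \<in> Field r" and "y \<in> Field r"
  shows "(x, y) \<in> r - Id \<longleftrightarrow> (y, x) \<notin> r"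
proof
  show "(y, x) \<notin> r" if "(x, y) \<in> r - Id"
    using that assms(1) by (auto simp: order_on_defs antisym_def)
  show "(x, y) \<in> r - Id" if "(y, x) \<notin> r"
    using that assms by (cases "x = y") (auto simp: order_on_defs refl_on_def total_on_def)
qed

text \<open>Nothing lies strictly between \<open>a\<close> and \<open>b\<close>, so by totality
  everything is below \<open>a\<close> or above \<open>b\<close>. Both cut constructions use the gap
  between neighbors in this form.\<close>

lemma Linear_order_le_iff_below_neighbor:
  assumes r: "Linear_order r" and n: "immediate_neighbors r a b" and x: "x \<in> Field r"
  shows "(x, a) \<in> r \<longleftrightarrow> (b, x) \<notin> r"
proof -
  have F: "a \<in> Field r" "b \<in> Field r"
    using n by (auto simp: immediate_neighbors_def intro: FieldI1 FieldI2)
  have "trans r" "antisym r" using r by (auto simp: order_on_defs)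
  then have "(b, x) \<notin> r" if "(x, a) \<in> r"
    using n that unfolding immediate_neighbors_def trans_def antisym_def by blast
  moreover have "(x, a) \<in> r" if "(b, x) \<notin> r"
    using that n Linear_order_less_iff[OF r x F(2)] Linear_order_less_iff[OF r F(1) x]
    unfolding immediate_neighbors_def by blast
  ultimately show ?thesis by blast
qed

lemma Restr_Linear_order:
  assumes "Linear_order r" and "A \<subseteq> Field r"
  shows "Field (Restr r A) = A" "Linear_order (Restr r A)"
proof -
  have refl: "\<And>x. x \<in> A \<Longrightarrow> (x, x) \<in> r"
    using assms unfolding order_on_defs refl_on_def by blast
  then show F: "Field (Restr r A) = A"
    by (auto simp: Field_def)
  show "Linear_order (Restr r A)"
    using assms refl unfolding F order_on_defs
    unfolding refl_on_def trans_def antisym_def total_on_def by blast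
qed

section \<open>Representing a total order by cuts\<close>

text \<open>The argument common to \<open>IS\<close> and \<open>IP\<close>. A cut is determined by
  its lower half, so \<open>f\<close> supplies only that half and \<open>surj\<close> only has to
  recover \<open>L\<close>.\<close>

lemma order_isomorphic_cut_orderI:
  assumes r: "Linear_order r" and A: "A \<subseteq> Field r"
    and cut: "\<And>x. x \<in> Field r \<Longrightarrow> is_cut (Restr r A) (f x, A - f x)"
    and mono: "\<And>x y. (x, y) \<in> r \<Longrightarrow> f x \<subseteq> f y"
    and strict: "\<And>x y. (x, y) \<in> r - Id \<Longrightarrow> f x \<noteq> f y"
    and surj: "\<And>L U. is_cut (Restr r A) (L, U) \<Longrightarrow> \<exists>x\<in>Field r. f x = L"
  shows "order_isomorphic r (cut_order (Restr r A))"
proof -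
  define g where "g x = (f x, A - f x)" for x
  have iff: "(x, y) \<in> r \<longleftrightarrow> (g x, g y) \<in> cut_order (Restr r A)"
    if xy: "x \<in> Field r" "y \<in> Field r" for x y
  proof -
    \<comment> \<open>If instead \<open>y\<close> were strictly below \<open>x\<close>, then
      \<open>mono\<close> would give \<open>f y = f x\<close>, which \<open>strict\<close>
      forbids.\<close>
    have "(x, y) \<in> r" if "f x \<subseteq> f y"
      using that mono[of y x] strict[of y x] Linear_order_less_iff[OF r xy(2,1)] by blast
    then show ?thesis
      using cut[OF xy(1)] cut[OF xy(2)] mono[of x y] by (auto simp: cut_order_def g_def)
  qed
  have "inj_on g (Field r)"
    using r strict unfolding inj_on_def order_on_defs total_on_def g_def
    by (metis Diff_iff IdD Pair_inject)
  moreover have "g ` Field r = {C. is_cut (Restr r A) C}"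
  proof (intro equalityI subsetI)
    fix C assume "C \<in> {C. is_cut (Restr r A) C}"
    then obtain L U where C: "C = (L, U)" "is_cut (Restr r A) (L, U)" by (cases C) auto
    then obtain x where x: "x \<in> Field r" "f x = L" using surj by blast
    have "U = A - L"
      using C(2) Restr_Linear_order(1)[OF r A] by (auto simp: is_cut_def)
    with x C(1) show "C \<in> g ` Field r" by (auto simp: g_def)
  qed (use cut in \<open>auto simp: g_def\<close>)
  ultimately have "bij_betw g (Field r) (Field (cut_order (Restr r A)))"
    by (simp add: bij_betw_def Field_cut_order)
  with iff show ?thesis
    unfolding order_isomorphic_def by blast
qed

lemma order_isomorphic_cut_order_IS:
  assumes r: "Linear_order r" and K2: "K2 r" and complete: "complete_order r"
  shows "order_isomorphic r (cut_order (IS r))"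
proof -
  define A where "A = {b \<in> Field r. \<exists>a. immediate_neighbors r a b}"
  have A: "A \<subseteq> Field r" by (auto simp: A_def)
  have tr: "trans r" and anti: "antisym r" and po: "Partial_order r"
    and refl: "\<And>x. x \<in> Field r \<Longrightarrow> (x, x) \<in> r"
    using r by (auto simp: order_on_defs refl_on_def)
  note less = Linear_order_less_iff[OF r]
  \<comment> \<open>The inequality is weak because the supremum of \<open>L\<close> may itself
    belong to \<open>L\<close>.\<close>
  define f where "f x = {a \<in> A. (a, x) \<in> r}" for x
  have "order_isomorphic r (cut_order (Restr r A))"
  proof (rule order_isomorphic_cut_orderI[OF r A, of f])
    fix x assume x: "x \<in> Field r"
    have "(a, b) \<in> Restr r A - Id" if "a \<in> f x" "b \<in> A - f x" for a b
    proof -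
      have "(a, x) \<in> r" "(x, b) \<in> r - Id" "a \<in> A" "b \<in> A"
        using that x A less[of x b] by (auto simp: f_def)
      then show ?thesis
        using tr anti unfolding trans_def antisym_def by blast
    qed
    then show "is_cut (Restr r A) (f x, A - f x)"
      unfolding is_cut_def Restr_Linear_order(1)[OF r A] by (auto simp: f_def)
  next
    fix x y assume "(x, y) \<in> r"
    then show "f x \<subseteq> f y"
      using tr unfolding f_def trans_def by blast
  next
    fix x y assume "(x, y) \<in> r - Id"
    then obtain p q where pq: "(x, p) \<in> r" "immediate_neighbors r p q" "(q, y) \<in> r"
      using K2 unfolding K2_def by blast
    then have "x \<in> Field r" "q \<in> A"
      by (auto simp: A_def intro: FieldI1)
    \<comment> \<open>The upper neighbor \<open>q\<close> separates the two cuts: it is below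
      \<open>y\<close>, but not below \<open>x\<close>, since \<open>x\<close> is below
      \<open>p\<close>.\<close>
    then have "(q, x) \<notin> r"
      using Linear_order_le_iff_below_neighbor[OF r pq(2)] pq(1) by blast
    with pq(3) \<open>q \<in> A\<close> show "f x \<noteq> f y" by (auto simp: f_def)
  next
    fix L U assume "is_cut (Restr r A) (L, U)"
    then have LU: "L \<union> U = A" "\<And>a b. a \<in> L \<Longrightarrow> b \<in> U \<Longrightarrow> (a, b) \<in> r - Id"
      unfolding is_cut_def Restr_Linear_order(1)[OF r A] by auto
    then have "L \<subseteq> Field r" using A by blast
    \<comment> \<open>For \<open>L = {}\<close> this supremum is the least element.\<close>
    then obtain m where m: "m \<in> Field r"
      "\<And>x. x \<in> Field r \<Longrightarrow> (m, x) \<in> r \<longleftrightarrow> (\<forall>s\<in>L. (s, x) \<in> r)"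
      using complete_order_lub[OF po complete] by metis
    \<comment> \<open>Everything in \<open>L\<close> is strictly below \<open>b\<close>, hence below
      its predecessor \<open>a\<close>. So \<open>m\<close> is below \<open>a\<close>, and
      \<open>b\<close> cannot be below \<open>m\<close>.\<close>
    have "(b, m) \<notin> r" if b: "b \<in> U" for b
    proof -
      have "b \<in> A" using b LU(1) by blast
      then obtain a where a: "immediate_neighbors r a b" by (auto simp: A_def)
      have "(s, a) \<in> r" if "s \<in> L" for s
      proof -
        have "s \<in> Field r" "(b, s) \<notin> r"
          using that LU b A \<open>b \<in> A\<close> less[of s b] by blast+
        then show ?thesis
          using Linear_order_le_iff_below_neighbor[OF r a] by blast
      qed
      moreover have "a \<in> Field r"
        using a by (auto simp: immediate_neighbors_def intro: FieldI1)
      ultimately show ?thesis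
        using m Linear_order_le_iff_below_neighbor[OF r a] by blast
    qed
    moreover have "(s, m) \<in> r" if "s \<in> L" for s
      using that m refl by blast
    ultimately have "f m = L"
      using LU(1) by (auto simp: f_def)
    with m(1) show "\<exists>x\<in>Field r. f x = L" by blast
  qed
  then show ?thesis by (simp add: IS_def A_def)
qed

lemma order_isomorphic_cut_order_IP:
  assumes r: "Linear_order r" and K2: "K2 r" and complete: "complete_order r"
  shows "order_isomorphic r (cut_order (IP r))"
proof -
  define A where "A = {a \<in> Field r. \<exists>b. immediate_neighbors r a b}"
  have A: "A \<subseteq> Field r" by (auto simp: A_def)
  have tr: "trans r" and anti: "antisym r"
    and refl: "\<And>x. x \<in> Field r \<Longrightarrow> (x, x) \<in> r"
    using r by (auto simp: order_on_defs refl_on_def)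
  note less = Linear_order_less_iff[OF r]
  \<comment> \<open>By totality this means \<open>a\<close> strictly below \<open>x\<close>. The
    inequality is strict because the infimum of \<open>U\<close> may itself belong to
    \<open>U\<close>.\<close>
  define f where "f x = {a \<in> A. (x, a) \<notin> r}" for x
  have "order_isomorphic r (cut_order (Restr r A))"
  proof (rule order_isomorphic_cut_orderI[OF r A, of f])
    fix x assume x: "x \<in> Field r"
    have "(a, b) \<in> Restr r A - Id" if "a \<in> f x" "b \<in> A - f x" for a b
    proof -
      have "(a, x) \<in> r - Id" "(x, b) \<in> r" "a \<in> A" "b \<in> A"
        using that x A less[of a x] by (auto simp: f_def)
      then show ?thesis
        using tr anti unfolding trans_def antisym_def by blast
    qed
    then show "is_cut (Restr r A) (f x, A - f x)"
      unfolding is_cut_def Restr_Linear_order(1)[OF r A] by (auto simp: f_def)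
  next
    fix x y assume "(x, y) \<in> r"
    then show "f x \<subseteq> f y"
      using tr unfolding f_def trans_def by blast
  next
    fix x y assume "(x, y) \<in> r - Id"
    then obtain p q where pq: "(x, p) \<in> r" "immediate_neighbors r p q" "(q, y) \<in> r"
      using K2 unfolding K2_def by blast
    then have "y \<in> Field r" "p \<in> A"
      by (auto simp: A_def immediate_neighbors_def intro: FieldI1 FieldI2)
    \<comment> \<open>Here the lower neighbor \<open>p\<close> separates the two cuts: it is
      strictly below \<open>y\<close>, but not strictly below \<open>x\<close>.\<close>
    then have "(y, p) \<notin> r"
      using Linear_order_le_iff_below_neighbor[OF r pq(2)] pq(3) by blast
    with pq(1) \<open>p \<in> A\<close> show "f x \<noteq> f y" by (auto simp: f_def)
  next
    fix L U assume "is_cut (Restr r A) (L, U)"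
    then have LU: "L \<union> U = A" "\<And>a b. a \<in> L \<Longrightarrow> b \<in> U \<Longrightarrow> (a, b) \<in> r - Id"
      unfolding is_cut_def Restr_Linear_order(1)[OF r A] by auto
    then have "U \<subseteq> Field r" using A by blast
    \<comment> \<open>The infimum of \<open>U\<close>; for \<open>U = {}\<close> it is the greatest
      element.\<close>
    then obtain m where m: "m \<in> Field r"
      "\<And>x. x \<in> Field r \<Longrightarrow> (x, m) \<in> r \<longleftrightarrow> (\<forall>s\<in>U. (x, s) \<in> r)"
      using complete unfolding complete_order_def by metis
    \<comment> \<open>The successor \<open>b\<close> of \<open>a\<close> is a lower bound of
      \<open>U\<close>, hence below \<open>m\<close>, so \<open>m\<close> cannot be below
      \<open>a\<close>.\<close>
    have "(m, a) \<notin> r" if a: "a \<in> L" for a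
    proof -
      have "a \<in> A" using a LU(1) by blast
      then obtain b where b: "immediate_neighbors r a b" by (auto simp: A_def)
      have "(b, s) \<in> r" if "s \<in> U" for s
      proof -
        have "s \<in> Field r" "(s, a) \<notin> r"
          using that LU a A \<open>a \<in> A\<close> less[of a s] by blast+
        then show ?thesis
          using Linear_order_le_iff_below_neighbor[OF r b] by blast
      qed
      moreover have "b \<in> Field r"
        using b by (auto simp: immediate_neighbors_def intro: FieldI2)
      ultimately show ?thesis
        using m Linear_order_le_iff_below_neighbor[OF r b] by blast
    qed
    moreover have "(m, s) \<in> r" if "s \<in> U" for s
      using that m refl by blast
    ultimately have "f m = L"
      using LU(1) by (auto simp: f_def)
    with m(1) show "\<exists>x\<in>Field r. f x = L" by blast
  qed
  then show ?thesis by (simp add: IP_def A_def)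
qed

section \<open>Maximal and prime two-sided ideals\<close>

text \<open>If neither \<open>I\<close> nor \<open>J\<close> is inside \<open>M\<close>, maximality
  makes both sums with \<open>M\<close> the whole ring, so 1 = m + i = n + j. Then 1 = m + i(n + j)
  = m + in + ij, which lies in \<open>M\<close> once the product of \<open>I\<close> and
  \<open>J\<close> does.\<close>

lemma (in ring) maximalideal_imp_prime_ideal:
  assumes "maximalideal M R"
  shows "prime_ideal R M"
proof -
  interpret M: maximalideal M R by fact
  have unit_split: "\<exists>m\<in>M. \<exists>i\<in>I. \<one> = m \<oplus> i" if I: "ideal I R" "\<not> I \<subseteq> M" for I
  proof -
    interpret I: ideal I R by fact
    have sum: "ideal (M <+> I) R"
      by (rule add_ideals[OF M.is_ideal I(1)])
    have "M \<subseteq> M <+> I"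
    proof
      fix m assume "m \<in> M"
      then have "m = m \<oplus> \<zero>" "\<zero> \<in> I" by (simp_all add: M.Icarr)
      then show "m \<in> M <+> I" using \<open>m \<in> M\<close> unfolding set_add_def' by blast
    qed
    moreover have "I \<subseteq> M <+> I"
    proof
      fix i assume "i \<in> I"
      then have "i = \<zero> \<oplus> i" "\<zero> \<in> M" by (simp_all add: I.Icarr)
      then show "i \<in> M <+> I" using \<open>i \<in> I\<close> unfolding set_add_def' by blast
    qed
    moreover have "M <+> I \<subseteq> carrier R"
      using sum by (simp add: additive_subgroup.a_subset ideal.axioms(1))
    ultimately have "M <+> I = carrier R"
      using M.I_maximal[OF sum] I(2) by blast
    then show ?thesis
      using one_closed unfolding set_add_def' by blast
  qed
  have "I \<subseteq> M \<or> J \<subseteq> M" if I: "ideal I R" and J: "ideal J R" and IJ: "I \<cdot> J \<subseteq> M" for I J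
  proof (rule ccontr)
    assume "\<not> ?thesis"
    then obtain m i n j where mi: "m \<in> M" "i \<in> I" "\<one> = m \<oplus> i" and nj: "n \<in> M" "j \<in> J" "\<one> = n \<oplus> j"
      using unit_split I J by meson
    have carr: "m \<in> carrier R" "i \<in> carrier R" "n \<in> carrier R" "j \<in> carrier R"
      using M.Icarr[OF mi(1)] ideal.Icarr[OF I mi(2)] M.Icarr[OF nj(1)] ideal.Icarr[OF J nj(2)] by auto
    have "i \<otimes> j \<in> M"
      using IJ ideal_prod.prod[OF mi(2) nj(2)] by blast
    moreover have "i \<otimes> n \<in> M"
      by (rule M.I_l_closed[OF nj(1) carr(2)])
    ultimately have "m \<oplus> (i \<otimes> n \<oplus> i \<otimes> j) \<in> M"
      using mi(1) by (simp add: M.a_closed)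
    also have "m \<oplus> (i \<otimes> n \<oplus> i \<otimes> j) = m \<oplus> i \<otimes> (n \<oplus> j)"
      using carr by (simp add: r_distr)
    also have "\<dots> = \<one>"
      using carr by (simp flip: mi(3) nj(3))
    finally show False
      using M.one_imp_carrier M.I_notcarr by blast
  qed
  then show ?thesis
    using M.is_ideal M.I_notcarr unfolding prime_ideal_def by auto
qed

text \<open>Zorn's lemma, starting from the zero ideal. Properness is expressed by omitting
  \<open>\<one>\<close>, a condition that passes to unions of chains.\<close>

lemma (in ring) exists_maximalideal:
  assumes "\<one> \<noteq> \<zero>"
  shows "\<exists>M. maximalideal M R"
proof -
  let ?A = "{I. ideal I R \<and> \<one> \<notin> I}"
  have "{\<zero>} \<in> ?A" using zeroideal assms by simp
  moreover have "\<Union>C \<in> ?A" if "C \<noteq> {}" "subset.chain ?A C" for C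
  proof -
    have "subset.chain {I. ideal I R} C"
      using that(2) unfolding subset.chain_def by auto
    from chain_Union_is_ideal[OF this] show ?thesis
      using that unfolding subset.chain_def by auto
  qed
  ultimately have "\<exists>M\<in>?A. \<forall>X\<in>?A. M \<subseteq> X \<longrightarrow> X = M"
    by (intro subset_Zorn_nonempty) auto
  then obtain M where M: "M \<in> ?A" "\<And>X. X \<in> ?A \<Longrightarrow> M \<subseteq> X \<Longrightarrow> X = M"
    by auto
  have "maximalideal M R"
  proof (rule maximalidealI)
    show "ideal M R" "carrier R \<noteq> M" using M(1) by auto
    show "J = M \<or> J = carrier R" if "ideal J R" "M \<subseteq> J" "J \<subseteq> carrier R" for J
      using that M(2)[of J] ideal.one_imp_carrier by auto
  qed
  then show ?thesis ..
qed

lemma (in ring) prime_ideal_Inter_chain: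
  assumes ne: "C \<noteq> {}" and prime: "\<And>P. P \<in> C \<Longrightarrow> prime_ideal R P"
    and chain: "\<And>P Q. P \<in> C \<Longrightarrow> Q \<in> C \<Longrightarrow> P \<subseteq> Q \<or> Q \<subseteq> P"
  shows "prime_ideal R (\<Inter>C)"
proof -
  have ideal: "ideal P R" "P \<subseteq> carrier R" "P \<noteq> carrier R" if "P \<in> C" for P
    using prime[OF that] unfolding prime_ideal_def
    by (auto dest: ideal.Icarr)
  have "ideal (\<Inter>C) R"
    using ideal ne by (intro i_Intersect) auto
  moreover have "\<Inter>C \<noteq> carrier R"
    using ideal ne by blast
  moreover have "I \<subseteq> \<Inter>C \<or> J \<subseteq> \<Inter>C"
    if "ideal I R" "ideal J R" and IJ: "I \<cdot> J \<subseteq> \<Inter>C" for I J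
  proof (rule ccontr)
    assume "\<not> ?thesis"
    then obtain P Q where PQ: "P \<in> C" "\<not> I \<subseteq> P" "Q \<in> C" "\<not> J \<subseteq> Q" by blast
    \<comment> \<open>\<open>N\<close> is the smaller of \<open>P\<close> and \<open>Q\<close>, so
      it contains neither \<open>I\<close> nor \<open>J\<close>, although it contains their
      product.\<close>
    then obtain N where "N \<in> C" "\<not> I \<subseteq> N" "\<not> J \<subseteq> N"
      using chain[of P Q] by blast
    then show False
      using prime[of N] that unfolding prime_ideal_def by blast
  qed
  ultimately show ?thesis
    unfolding prime_ideal_def by blast
qed

section \<open>Completeness of a totally ordered spectrum\<close>

lemma (in ring) complete_order_Spec:
  assumes "\<one> \<noteq> \<zero>" and "Linear_order (Spec R)"
  shows "complete_order (Spec R)"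
proof -
  have total: "P \<subseteq> Q \<or> Q \<subseteq> P" if "prime_ideal R P" "prime_ideal R Q" for P Q
    using assms(2) that unfolding order_on_defs total_on_def Field_Spec
    by (auto simp: Spec_def)
  have "\<exists>m\<in>Field (Spec R). \<forall>x\<in>Field (Spec R). (x, m) \<in> Spec R \<longleftrightarrow> (\<forall>s\<in>S. (x, s) \<in> Spec R)"
    if S: "S \<subseteq> Field (Spec R)" for S
  proof (cases "S = {}")
    \<comment> \<open>The intersection of the empty family is the whole type, so a greatest prime
      ideal must be found separately.\<close>
    case True
    obtain M where M: "maximalideal M R"
      using exists_maximalideal[OF assms(1)] by blast
    then have prime: "prime_ideal R M" by (rule maximalideal_imp_prime_ideal)
    \<comment> \<open>By totality \<open>P\<close> is comparable with \<open>M\<close>; if it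
      contains \<open>M\<close>, maximality and properness force equality.\<close>
    have "P \<subseteq> M" if P: "prime_ideal R P" for P
    proof -
      have "ideal P R" "P \<noteq> carrier R" "P \<subseteq> carrier R"
        using P unfolding prime_ideal_def by (auto dest: ideal.Icarr)
      then show ?thesis
        using total[OF P prime] maximalideal.I_maximal[OF M] by blast
    qed
    with True prime show ?thesis
      unfolding Field_Spec by (auto simp: Spec_def)
  next
    case False
    then have "prime_ideal R (\<Inter>S)"
      using S total unfolding Field_Spec by (intro prime_ideal_Inter_chain) blast+
    with S show ?thesis
      unfolding Field_Spec by (intro bexI[of _ "\<Inter>S"]) (auto simp: Spec_def)
  qed
  then show ?thesis
    unfolding complete_order_def by blast
qed

theorem theorem3p1:
  fixes R :: "('a, 'b) ring_scheme"
  assumes "ring R" and "\<one>\<^bsub>R\<^esub> \<noteq> \<zero>\<^bsub>R\<^esub>"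
    and "K2 (Spec R)"
    and "Linear_order (Spec R)"
  shows "order_isomorphic (Spec R) (cut_order (IS (Spec R))) \<and>
    order_isomorphic (Spec R) (cut_order (IP (Spec R))) \<and>
    (\<exists>T' :: 'a set rel. dedekind_order T' \<and> order_isomorphic (Spec R) T')"
proof -
  have complete: "complete_order (Spec R)"
    by (rule ring.complete_order_Spec[OF assms(1,2,4)])
  note IS = order_isomorphic_cut_order_IS[OF assms(4,3) complete]
  have "Linear_order (IS (Spec R))"
    unfolding IS_def by (rule Restr_Linear_order(2)[OF assms(4)]) blast
  \<comment> \<open>\<open>Spec R\<close> itself serves as \<open>T'\<close>, presented as the cuts
    of \<open>IS (Spec R)\<close>.\<close>
  then have "dedekind_order (Spec R)"
    by (rule dedekind_orderI[OF assms(4) _ IS])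
  moreover have "order_isomorphic (Spec R) (Spec R)"
    unfolding order_isomorphic_def by (intro exI[of _ id]) simp
  ultimately show ?thesis
    using IS order_isomorphic_cut_order_IP[OF assms(4,3) complete] by blast
qed

end
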